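(* For all integers $n\ge1$ and $k\ge1$, the residue of $\mathfrak B_{2n}^{(-k)}$ modulo $7$ depends only on $n\bmod 6$ and $k\bmod 6$, and is given, listing the values for $k\equiv 0,1,2,3,4,5\pmod 6$ in that order, by: $n\equiv 0\pmod 6$: $6,6,0,1,1,0$; $n\equiv 1\pmod 6$: $2,6,4,5,1,3$; $n\equiv 2\pmod 6$: $1,2,1,6,5,6$; $n\equiv 3\pmod 6$: $1,1,0,6,6,0$; $n\equiv 4\pmod 6$: $5,1,3,2,6,4$; $n\equiv 5\pmod 6$: $6,5,6,1,2,1$.
   Context: For an integer $k$, the poly-Bernoulli numbers with level $2$, $\mathfrak B_n^{(k)}$, are defined by the power series identity $$\sum_{n=0}^\infty\mathfrak B_n^{(k)}\frac{x^n}{n!}=\frac{{\rm Li}_{2,k}\bigl(2\sin(x/2)\bigr)}{2\sin(x/2)}=\sum_{m=0}^\infty\frac{\bigl(2\sin(x/2)\bigr)^{2m}}{(2m+1)^k},$$ where ${\rm Li}_{2,k}(z)=\sum_{n=0}^\infty\frac{z^{2n+1}}{(2n+1)^k}$. For $k\le 0$ these numbers are integers. *)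

theory Defs
  imports "HOL-Computational_Algebra.Formal_Power_Series"
begin

definition Li2_fps :: "int \<Rightarrow> rat fps" where
  "Li2_fps k = Abs_fps (\<lambda>m. if odd m then 1 / (of_nat m powi k) else 0)"

text \<open>\<open>fps_sin c\<close> is the expansion of \<open>sin (c x)\<close>, so this is \<open>2 sin (x / 2)\<close>.\<close>

definition two_sin_half :: "rat fps" where
  "two_sin_half = 2 * fps_sin (1 / 2)"

text \<open>
  The numbers are read off an exponential generating function, hence the factor \<open>fact n\<close>.
  The division is exact: numerator and denominator both have subdegree 1.
\<close>

definition poly_bernoulli2 :: "int \<Rightarrow> nat \<Rightarrow> rat" where
  "poly_bernoulli2 k n = fact n * fps_nth ((Li2_fps k oo two_sin_half) / two_sin_half) n"

lemma poly_bernoulli2_egf: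
  "Abs_fps (\<lambda>n. poly_bernoulli2 k n / fact n) = (Li2_fps k oo two_sin_half) / two_sin_half"
  by (rule fps_ext) (simp add: poly_bernoulli2_def)

text \<open>The second form of the generating function, \<open>\<Sum>m. (2 sin (x / 2)) ^ (2 m) / (2 m + 1) ^ k\<close>.\<close>

lemma poly_bernoulli2_egf_series:
  "Abs_fps (\<lambda>n. poly_bernoulli2 k n / fact n) =
   Abs_fps (\<lambda>m. if even m then 1 / (of_nat (m + 1) powi k) else 0) oo two_sin_half"
proof -
  let ?A = "Abs_fps (\<lambda>m. if even m then 1 / (of_nat (m + 1) powi k) else 0) :: rat fps"
  have 0: "fps_nth two_sin_half 0 = 0"
    by (simp add: two_sin_half_def)
  have "fps_nth two_sin_half 1 = 1"
    by (simp add: two_sin_half_def fps_sin_def numeral_fps_const)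
  then have nz: "two_sin_half \<noteq> 0"
    by auto
  have "Li2_fps k = fps_X * ?A"
  proof (rule fps_ext)
    fix m
    show "fps_nth (Li2_fps k) m = fps_nth (fps_X * ?A) m"
      by (cases m) (simp_all add: Li2_fps_def)
  qed
  then have "Li2_fps k oo two_sin_half = (?A oo two_sin_half) * two_sin_half"
    using 0 by (simp add: fps_compose_mult_distrib mult.commute)
  then show ?thesis
    using nz by (simp add: poly_bernoulli2_egf)
qed

end

theory Submission
  imports Defs "HOL-Number_Theory.Cong"
begin

text \<open>
  Write \<open>s = 2 sin (x / 2)\<close>. Since \<open>s'\<^sup>2 = 1 - s\<^sup>2 / 4\<close> and \<open>s'' = - s / 4\<close>, differentiating
  \<open>s ^ (2 m)\<close> twice shows that its coefficients, scaled by \<open>(2 n)! / (2 m)!\<close>, are integers \<open>d m n\<close>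
  satisfying \<open>d m (n + 1) = d (m - 1) n - m\<^sup>2 d m n\<close>. Hence the poly-Bernoulli number of index \<open>2 n\<close>
  and upper index \<open>- k\<close> is \<open>\<Sum>m\<le>n. (2 m + 1) ^ k (2 m)! d m n\<close>. Modulo 7 only \<open>m = 1\<close> and \<open>m = 2\<close>
  contribute: \<open>d 0 n = 0\<close>, the base \<open>2 m + 1\<close> is 7 for \<open>m = 3\<close>, and 7 divides \<open>(2 m)!\<close> for \<open>m \<ge> 4\<close>.
  All remaining factors have period 6.
\<close>

text \<open>Up to the sign \<open>(-1) ^ (n - m)\<close>, these are the central factorial numbers of
  the second kind \<open>T(2 n, 2 m)\<close>.\<close>

fun signed_central_factorial :: "nat \<Rightarrow> nat \<Rightarrow> int" where
  "signed_central_factorial 0 0 = 1"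
| "signed_central_factorial 0 (Suc n) = 0"
| "signed_central_factorial (Suc m) 0 = 0"
| "signed_central_factorial (Suc m) (Suc n) =
     signed_central_factorial m n - (int (Suc m))\<^sup>2 * signed_central_factorial (Suc m) n"

lemma two_sin_half_nth_0: "fps_nth two_sin_half 0 = 0"
  by (simp add: two_sin_half_def)

lemma deriv_two_sin_half: "fps_deriv two_sin_half = fps_cos (1 / 2)"
proof -
  have "fps_deriv two_sin_half = 2 * (fps_const (1 / 2) * fps_cos (1 / 2))"
    by (simp add: two_sin_half_def fps_sin_deriv)
  also have "\<dots> = fps_cos (1 / 2)"
    by (simp add: fps_numeral_fps_const flip: mult.assoc)
  finally show ?thesis .
qed

lemma deriv2_two_sin_half:
  "fps_deriv (fps_cos (1 / 2)) = - (fps_const (1 / 4) * two_sin_half)"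
proof -
  have "fps_const (1 / 4 :: rat) * 2 = fps_const (1 / 2)"
    by (simp add: fps_numeral_fps_const)
  then show ?thesis
    by (simp add: two_sin_half_def fps_cos_deriv flip: mult.assoc fps_const_neg)
qed

lemma cos_half_square: "(fps_cos (1 / 2))\<^sup>2 = 1 - fps_const (1 / 4) * two_sin_half\<^sup>2"
proof -
  have "fps_const (1 / 4 :: rat) * 4 = 1"
    by (simp add: fps_numeral_fps_const)
  then have "fps_const (1 / 4) * two_sin_half\<^sup>2 = (fps_sin (1 / 2))\<^sup>2"
    by (simp add: two_sin_half_def power_mult_distrib flip: mult.assoc)
  then show ?thesis
    using fps_sin_cos_sum_of_squares[of "1 / 2 :: rat"] by (simp add: eq_diff_eq)
qed

text \<open>With \<open>j = i + 2\<close>, the second derivative of \<open>s ^ j\<close> is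
  \<open>j (j - 1) s ^ i s'^2 + j s ^ (j - 1) s''\<close>. Eliminating \<open>s'^2\<close> and
  \<open>s''\<close> leaves \<open>s ^ j\<close> with coefficient
  \<open>- (j (j - 1) + j) / 4 = - j^2 / 4\<close>.\<close>

lemma deriv2_two_sin_half_power:
  "fps_deriv (fps_deriv (two_sin_half ^ (i + 2))) =
     of_nat ((i + 2) * (i + 1)) * two_sin_half ^ i
     - fps_const (1 / 4) * of_nat ((i + 2)\<^sup>2) * two_sin_half ^ (i + 2)"
proof -
  define s c q :: "rat fps"
    where "s = two_sin_half" and "c = fps_cos (1 / 2)" and "q = fps_const (1 / 4)"
  have ds: "fps_deriv s = c" and dc: "fps_deriv c = - (q * s)" and cc: "c\<^sup>2 = 1 - q * s\<^sup>2"
    by (simp_all add: s_def c_def q_def deriv_two_sin_half deriv2_two_sin_half cos_half_square)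
  have dp: "fps_deriv (s ^ (j + 1)) = of_nat (j + 1) * (c * s ^ j)" for j
    using fps_deriv_power[of s "j + 1"] by (simp del: power_Suc of_nat_Suc add: ds fps_of_nat mult.assoc)
  have 1: "fps_deriv (s ^ (i + 2)) = of_nat (i + 2) * (c * s ^ (i + 1))"
    using dp[of "i + 1"] by simp
  have "fps_deriv (fps_deriv (s ^ (i + 2))) =
      of_nat (i + 2) * (of_nat (i + 1) * (c\<^sup>2 * s ^ i) - q * (s * s ^ (i + 1)))"
    unfolding 1 by (simp del: power_Suc of_nat_Suc of_nat_add add: dp[unfolded Suc_eq_plus1[symmetric]] dc algebra_simps power2_eq_square)
  also have "\<dots> = of_nat ((i + 2) * (i + 1)) * s ^ i - q * of_nat ((i + 2)\<^sup>2) * s ^ (i + 2)"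
    unfolding cc by (simp add: algebra_simps power2_eq_square)
  finally show ?thesis
    unfolding s_def q_def .
qed

lemma two_sin_half_power_nth:
  "fact (2 * n) * fps_nth (two_sin_half ^ (2 * m)) (2 * n) =
     fact (2 * m) * of_int (signed_central_factorial m n)"
proof (induction m n rule: signed_central_factorial.induct)
  case 1
  then show ?case by simp
next
  case (2 n)
  then show ?case by simp
next
  case (3 m)
  then show ?case by (simp add: two_sin_half_nth_0)
next
  case (4 m n)
  let ?c = "\<lambda>i j. fps_nth (two_sin_half ^ i) j"
  have "fps_nth (fps_deriv (fps_deriv (two_sin_half ^ (2 * m + 2)))) (2 * n) =
      of_nat ((2 * m + 2) * (2 * m + 1)) * ?c (2 * m) (2 * n)
      - 1 / 4 * of_nat ((2 * m + 2)\<^sup>2) * ?c (2 * m + 2) (2 * n)"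
    unfolding deriv2_two_sin_half_power
    by (simp only: fps_sub_nth mult.assoc fps_mult_left_const_nth flip: fps_of_nat)
  \<comment> \<open>Two derivatives shift the coefficient index by 2, and
    \<open>(2 m + 2)^2 / 4 = (m + 1)^2\<close> is the factor in the recursion.\<close>
  then have rec: "of_nat ((2 * n + 2) * (2 * n + 1)) * ?c (2 * m + 2) (2 * n + 2) =
      of_nat ((2 * m + 2) * (2 * m + 1)) * ?c (2 * m) (2 * n)
      - of_nat ((m + 1)\<^sup>2) * ?c (2 * m + 2) (2 * n)"
    by (simp del: power_Suc add: algebra_simps power2_eq_square)
  have "fact (2 * Suc n) * ?c (2 * Suc m) (2 * Suc n) =
      fact (2 * n) * (of_nat ((2 * n + 2) * (2 * n + 1)) * ?c (2 * m + 2) (2 * n + 2))"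
    by (simp del: power_Suc add: algebra_simps)
  also have "\<dots> = of_nat ((2 * m + 2) * (2 * m + 1)) * (fact (2 * n) * ?c (2 * m) (2 * n))
      - of_nat ((m + 1)\<^sup>2) * (fact (2 * n) * ?c (2 * Suc m) (2 * n))"
    unfolding rec by (simp only: right_diff_distrib mult.left_commute) simp
  also have "\<dots> = fact (2 * Suc m) * of_int (signed_central_factorial (Suc m) (Suc n))"
    unfolding 4 by (simp add: algebra_simps power2_eq_square)
  finally show ?case .
qed

lemma sum_even_support:
  fixes f :: "nat \<Rightarrow> 'a::comm_monoid_add"
  assumes "\<And>i. odd i \<Longrightarrow> f i = 0"
  shows "(\<Sum>i=0..2 * n. f i) = (\<Sum>m\<le>n. f (2 * m))"
  using assms by (induction n) simp_all

text \<open>The negative upper index moves \<open>(2 m + 1) ^ k\<close> into the numerator, so every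
  term is an integer. The composition sum stops at \<open>2 n\<close> because
  \<open>two_sin_half\<close> has no constant term.\<close>

lemma poly_bernoulli2_even_nonpos:
  "poly_bernoulli2 (- int k) (2 * n) =
     of_int (\<Sum>m\<le>n. (2 * int m + 1) ^ k * fact (2 * m) * signed_central_factorial m n)"
proof -
  let ?a = "\<lambda>m. if even m then 1 / (of_nat (m + 1) powi (- int k)) else 0 :: rat"
  have "poly_bernoulli2 (- int k) (2 * n) =
      fact (2 * n) * fps_nth (Abs_fps ?a oo two_sin_half) (2 * n)"
    unfolding poly_bernoulli2_egf_series[symmetric] by simp
  also have "\<dots> = fact (2 * n) * (\<Sum>m\<le>n. ?a (2 * m) * fps_nth (two_sin_half ^ (2 * m)) (2 * n))"
    by (simp add: fps_compose_nth sum_even_support)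
  also have "\<dots> = (\<Sum>m\<le>n. ?a (2 * m) * (fact (2 * n) * fps_nth (two_sin_half ^ (2 * m)) (2 * n)))"
    by (simp add: sum_distrib_left mult.left_commute)
  also have "\<dots> = of_int (\<Sum>m\<le>n. (2 * int m + 1) ^ k * fact (2 * m) * signed_central_factorial m n)"
    unfolding two_sin_half_power_nth
    by (simp add: power_int_minus field_simps)
  finally show ?thesis .
qed

lemma signed_central_factorial_eq_0: "n < m \<Longrightarrow> signed_central_factorial m n = 0"
  by (induction m n rule: signed_central_factorial.induct) simp_all

lemma seven_dvd_fact:
  assumes "m \<ge> 4"
  shows "(7::int) dvd fact (2 * m)"
proof -
  have "int 7 dvd int (fact (2 * m))"
    using assms by (simp only: int_dvd_int_iff dvd_fact)
  then show ?thesis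
    by simp
qed

lemma central_factorial_sum_mod_7:
  assumes "n \<ge> 1" and "k \<ge> 1"
  shows "[(\<Sum>m\<le>n. (2 * int m + 1) ^ k * fact (2 * m) * signed_central_factorial m n) =
    3 ^ k * 2 * signed_central_factorial 1 n + 5 ^ k * 3 * signed_central_factorial 2 n] (mod 7)"
proof -
  let ?f = "\<lambda>m. (2 * int m + 1) ^ k * fact (2 * m) * signed_central_factorial m n"
  \<comment> \<open>Padding with vanishing terms lets the indices 0 to 3 be split off even when
    \<open>n < 3\<close>.\<close>
  have "(\<Sum>m\<le>n. ?f m) = (\<Sum>m<n + 4. ?f m)"
    by (intro sum.mono_neutral_left) (auto simp: signed_central_factorial_eq_0)
  also have "{..<n + 4} = {0, 1, 2, 3} \<union> {4..<n + 4}"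
    by auto
  also have "sum ?f \<dots> = ?f 0 + ?f 1 + ?f 2 + ?f 3 + (\<Sum>m=4..<n + 4. ?f m)"
    by (subst sum.union_disjoint) auto
  finally have split: "(\<Sum>m\<le>n. ?f m) = \<dots>" .
  have 0: "?f 0 = 0"
    using assms by (cases n) auto
  \<comment> \<open>Here \<open>4! = 24 = 3 + 7 * 3\<close>.\<close>
  have 2: "?f 2 = 5 ^ k * 3 * signed_central_factorial 2 n
      + 7 * (3 * 5 ^ k * signed_central_factorial 2 n)"
    by (simp add: fact_numeral)
  have "7 dvd ?f 3"
    using assms by (simp add: dvd_power)
  moreover have "7 dvd (\<Sum>m=4..<n + 4. ?f m)"
    by (intro dvd_sum dvd_mult2[OF dvd_mult[OF seven_dvd_fact]]) simp
  ultimately have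
    "7 dvd 7 * (3 * 5 ^ k * signed_central_factorial 2 n) + ?f 3 + (\<Sum>m=4..<n + 4. ?f m)"
    by (intro dvd_add dvd_triv_left)
  then show ?thesis
    unfolding split 0 2 cong_iff_dvd_diff by (simp add: algebra_simps)
qed

lemma mod_6_cases:
  fixes n :: nat
  shows "n mod 6 = 0 \<or> n mod 6 = 1 \<or> n mod 6 = 2 \<or> n mod 6 = 3 \<or> n mod 6 = 4 \<or> n mod 6 = 5"
  using mod_less_divisor[of 6 n] by linarith

text \<open>3 is a primitive root modulo 7, as is its inverse 5 below.\<close>

lemma power_3_mod_7: "3 ^ k mod 7 = [1, 3, 2, 6, 4, 5 :: int] ! (k mod 6)"
proof (induction k)
  case (Suc k)
  have "3 ^ Suc k mod 7 = 3 * (3 ^ k mod 7) mod (7::int)"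
    by (simp add: mod_mult_right_eq)
  with Suc show ?case
    using mod_6_cases[of k] by (auto simp: mod_Suc)
qed simp

lemma power_5_mod_7: "5 ^ k mod 7 = [1, 5, 4, 6, 2, 3 :: int] ! (k mod 6)"
proof (induction k)
  case (Suc k)
  have "5 ^ Suc k mod 7 = 5 * (5 ^ k mod 7) mod (7::int)"
    by (simp add: mod_mult_right_eq)
  with Suc show ?case
    using mod_6_cases[of k] by (auto simp: mod_Suc)
qed simp


text \<open>The recursion only flips the sign, since the entries with \<open>m = 0\<close> vanish
  for \<open>n \<ge> 1\<close>. The list entry at 0 stands for \<open>n = 6, 12, ...\<close>; at
  \<open>n = 0\<close> itself the value is 0.\<close>

lemma signed_central_factorial_1_mod_7:
  "n \<ge> 1 \<Longrightarrow> signed_central_factorial 1 n mod 7 = [6, 1, 6, 1, 6, 1] ! (n mod 6)"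
proof (induction n rule: dec_induct)
  case (step n)
  have "signed_central_factorial 1 (Suc n) mod 7 = - signed_central_factorial 1 n mod 7"
    using step.hyps by (cases n) simp_all
  also have "\<dots> = - (signed_central_factorial 1 n mod 7) mod 7"
    by (simp add: mod_minus_eq)
  finally show ?case
    using step.IH mod_6_cases[of n] by (auto simp: mod_Suc)
qed simp

text \<open>The recursion multiplies by \<open>-4\<close>, which is 3 modulo 7 and has order 6, and
  adds the alternating sequence of the previous lemma; hence the period 6.\<close>

lemma signed_central_factorial_2_mod_7:
  "n \<ge> 1 \<Longrightarrow> signed_central_factorial 2 n mod 7 = [5, 0, 1, 2, 0, 6] ! (n mod 6)"
proof (induction n rule: dec_induct)
  case (step n)
  have "signed_central_factorial 2 (Suc n) mod 7 =
      (signed_central_factorial 1 n - 4 * signed_central_factorial 2 n) mod 7"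
    by (simp add: numeral_2_eq_2)
  also have "\<dots> =
      (signed_central_factorial 1 n mod 7 - 4 * (signed_central_factorial 2 n mod 7)) mod 7"
    unfolding cong_def[symmetric]
    by (intro cong_diff cong_mult cong_refl) (simp_all only: cong_def mod_mod_trivial)
  finally show ?case
    using step.IH signed_central_factorial_1_mod_7[OF step.hyps(1)] mod_6_cases[of n]
    by (auto simp: mod_Suc)
qed (simp add: numeral_2_eq_2)

theorem theorem13:
  fixes n k :: nat
  assumes "n \<ge> 1" and "k \<ge> 1"
  shows "\<exists>z::int. poly_bernoulli2 (- int k) (2 * n) = of_int z \<and>
    z mod 7 =
      [[6, 6, 0, 1, 1, 0],
       [2, 6, 4, 5, 1, 3],
       [1, 2, 1, 6, 5, 6],
       [1, 1, 0, 6, 6, 0],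
       [5, 1, 3, 2, 6, 4],
       [6, 5, 6, 1, 2, 1]] ! (n mod 6) ! (k mod 6)"
proof (intro exI conjI)
  let ?z = "\<Sum>m\<le>n. (2 * int m + 1) ^ k * fact (2 * m) * signed_central_factorial m n"
  show "poly_bernoulli2 (- int k) (2 * n) = of_int ?z"
    by (rule poly_bernoulli2_even_nonpos)
  have "?z mod 7 =
      (3 ^ k * 2 * signed_central_factorial 1 n + 5 ^ k * 3 * signed_central_factorial 2 n) mod 7"
    using central_factorial_sum_mod_7[OF assms] by (simp add: cong_def)
  also have "\<dots> = ((3 ^ k mod 7) * 2 * (signed_central_factorial 1 n mod 7)
      + (5 ^ k mod 7) * 3 * (signed_central_factorial 2 n mod 7)) mod 7"
    unfolding cong_def[symmetric]
    by (intro cong_add cong_mult cong_refl) (simp_all only: cong_def mod_mod_trivial)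
  also have "\<dots> =
      [[6, 6, 0, 1, 1, 0],
       [2, 6, 4, 5, 1, 3],
       [1, 2, 1, 6, 5, 6],
       [1, 1, 0, 6, 6, 0],
       [5, 1, 3, 2, 6, 4],
       [6, 5, 6, 1, 2, 1]] ! (n mod 6) ! (k mod 6)"
    \<comment> \<open>All four factors are now table lookups, leaving 36 numerical checks.\<close>
    unfolding power_3_mod_7 power_5_mod_7 signed_central_factorial_1_mod_7[OF assms(1)]
      signed_central_factorial_2_mod_7[OF assms(1)]
    using mod_6_cases[of n] mod_6_cases[of k] by (elim disjE) simp_all
  finally show "?z mod 7 = \<dots>" .
qed

end
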